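(* Let $m\ge2$, let $H_1,\dots,H_m$ be hypotheses with $p$-values $p_1,\dots,p_m$, and for each size $k\in\{1,\dots,m\}$ let a test statistic $h(\boldsymbol Y^{\mathcal J})$ satisfying conditions (C1), (C2), (C3) of the context be given; assume the $p$-values are realized from an exchangeable distribution. Let $\alpha\in(0,1)$ and let $t_\alpha:=\max\{|\mathcal K|:\emptyset\ne\mathcal K\subseteq\mathcal I,\ H_{\mathcal K}\text{ is not rejected by the Closed Testing Procedure at level }\alpha\}$ (with $t_\alpha:=0$ if there is no such $\mathcal K$). Then there is an algorithm which, given the sorted $p$-values, determines $t_\alpha$ by computing at most $O(m)$ of the local $p$-values $\phi^{\mathcal J}$ (at most one for each size $|\mathcal J|\in\{1,\dots,m\}$), and hence outputs the set $\{m-t_\alpha,\dots,m\}$, which is a $1-\alpha$ confidence set for the number of false hypotheses among $H_1,\dots,H_m$, i.e. it contains that number with probability at least $1-\alpha$.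
   Context: Let $\mathcal I=\{1,\dots,m\}$ and for $\emptyset\ne\mathcal J\subseteq\mathcal I$ let $H_{\mathcal J}:=\bigcap_{j\in\mathcal J}H_j$, true iff all $H_j$, $j\in\mathcal J$, are true. For each size $k$, fix $\mathcal X\subseteq\mathbb R$, functions $F_{(1)},\dots,F_{(k)}:[0,1]\to\mathcal X$ and $h:\mathcal X^k\to[0,1]$ (these may depend on $k$). For $|\mathcal J|=k$ let $p^{\mathcal J}_{(1)}\le\dots\le p^{\mathcal J}_{(k)}$ be the sorted values of $(p_j)_{j\in\mathcal J}$ and $\boldsymbol Y^{\mathcal J}:=(F_{(1)}(p^{\mathcal J}_{(1)}),\dots,F_{(k)}(p^{\mathcal J}_{(k)}))$. Conditions: (C1) each $F_{(j)}$ is nondecreasing on $[0,1]$; (C2) $F_{(j)}(x)\ge F_{(j+1)}(x)$ for all $j\in\{1,\dots,k-1\}$ and $x\in[0,1]$; (C3) $h(\boldsymbol x)\le h(\boldsymbol x+\boldsymbol\epsilon)$ for all $\boldsymbol\epsilon\in[0,\infty)^k$ with $\boldsymbol x,\boldsymbol x+\boldsymbol\epsilon\in\mathcal X^k$. Exchangeability means that under the null any two subsets of $p$-values of equal size have the same joint distribution; thus for each $k$ there is one CDF $G_k$ such that, whenever $|\mathcal J|=k$ and $H_{\mathcal J}$ is true, $h(\boldsymbol Y^{\mathcal J})$ has CDF $G_k$. Small values are critical and the local $p$-value is $\phi^{\mathcal J}:=G_{|\mathcal J|}(h(\boldsymbol Y^{\mathcal J}))$ for $|\mathcal J|\ge2$,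 and $\phi^{\{i\}}:=p_i$, where $\mathbb P(p_i\le\alpha)\le\alpha$ for all $\alpha$ if $H_i$ is true. The Closed Testing Procedure rejects $H_{\mathcal J}$ at level $\alpha$ iff $\phi^{\mathcal K}\le\alpha$ for every $\mathcal K$ with $\mathcal J\subseteq\mathcal K\subseteq\mathcal I$. *)

theory Defs
  imports
    "HOL-Probability.Probability"
    "HOL-Library.Landau_Symbols"
    "HOL-Combinatorics.Permutations"
begin

section \<open>Test statistics and local p-values\<close>

text \<open>
  Vectors with \<open>k\<close> entries are lists of length \<open>k\<close>; entry number \<open>j\<close> (counted from 1) of such a
  vector \<open>xs\<close> is \<open>xs ! (j - 1)\<close>.
\<close>

definition vectors :: "nat \<Rightarrow> real set \<Rightarrow> real list set" where
  "vectors k X = {xs. length xs = k \<and> set xs \<subseteq> X}"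

definition cond_C1 :: "nat \<Rightarrow> (nat \<Rightarrow> real \<Rightarrow> real) \<Rightarrow> bool" where
  "cond_C1 k F \<longleftrightarrow> (\<forall>j\<in>{1..k}. mono_on {0..1} (F j))"

definition cond_C2 :: "nat \<Rightarrow> (nat \<Rightarrow> real \<Rightarrow> real) \<Rightarrow> bool" where
  "cond_C2 k F \<longleftrightarrow> (\<forall>j\<in>{1..<k}. \<forall>x\<in>{0..1}. F j x \<ge> F (Suc j) x)"

definition cond_C3 :: "nat \<Rightarrow> real set \<Rightarrow> (real list \<Rightarrow> real) \<Rightarrow> bool" where
  "cond_C3 k X h \<longleftrightarrow>
     (\<forall>xs \<epsilon>. xs \<in> vectors k X \<longrightarrow> \<epsilon> \<in> vectors k {0..} \<longrightarrow> map2 (+) xs \<epsilon> \<in> vectors k X \<longrightarrow>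
        h xs \<le> h (map2 (+) xs \<epsilon>))"

definition test_statistic :: "nat \<Rightarrow> real set \<Rightarrow> (nat \<Rightarrow> real \<Rightarrow> real) \<Rightarrow> (real list \<Rightarrow> real) \<Rightarrow> bool" where
  "test_statistic k X F h \<longleftrightarrow>
     (\<forall>j\<in>{1..k}. F j \<in> {0..1} \<rightarrow> X) \<and> h \<in> vectors k X \<rightarrow> {0..1} \<and>
     cond_C1 k F \<and> cond_C2 k F \<and> cond_C3 k X h"

text \<open>
  Below, \<open>q i\<close> is the realized value of the \<open>i\<close>-th p-value.  The families \<open>F\<close>, \<open>h\<close>, \<open>G\<close> carry the
  size \<open>k\<close> as first argument, so \<open>F k j\<close> is the function $F_{(j)}$ used for subsets of size \<open>k\<close>.
\<close>

definition sorted_pvalues :: "(nat \<Rightarrow> real) \<Rightarrow> nat set \<Rightarrow> real list" where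
  "sorted_pvalues q J = sort (map q (sorted_list_of_set J))"

definition Y_vec :: "(nat \<Rightarrow> nat \<Rightarrow> real \<Rightarrow> real) \<Rightarrow> (nat \<Rightarrow> real) \<Rightarrow> nat set \<Rightarrow> real list" where
  "Y_vec F q J = map2 (F (card J)) [1..<Suc (card J)] (sorted_pvalues q J)"

definition stat ::
  "(nat \<Rightarrow> nat \<Rightarrow> real \<Rightarrow> real) \<Rightarrow> (nat \<Rightarrow> real list \<Rightarrow> real) \<Rightarrow> (nat \<Rightarrow> real) \<Rightarrow> nat set \<Rightarrow> real" where
  "stat F h q J = h (card J) (Y_vec F q J)"

definition local_pvalue ::
  "(nat \<Rightarrow> nat \<Rightarrow> real \<Rightarrow> real) \<Rightarrow> (nat \<Rightarrow> real list \<Rightarrow> real) \<Rightarrow> (nat \<Rightarrow> real \<Rightarrow> real) \<Rightarrow>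
   (nat \<Rightarrow> real) \<Rightarrow> nat set \<Rightarrow> real" where
  "local_pvalue F h G q J =
     (if card J = 1 then q (the_elem J) else G (card J) (stat F h q J))"


section \<open>The closed testing procedure\<close>

definition ctp_rejects :: "nat \<Rightarrow> (nat set \<Rightarrow> real) \<Rightarrow> real \<Rightarrow> nat set \<Rightarrow> bool" where
  "ctp_rejects m \<phi> \<alpha> J \<longleftrightarrow> (\<forall>K. J \<subseteq> K \<and> K \<subseteq> {1..m} \<longrightarrow> \<phi> K \<le> \<alpha>)"

definition t_alpha :: "nat \<Rightarrow> (nat set \<Rightarrow> real) \<Rightarrow> real \<Rightarrow> nat" where
  "t_alpha m \<phi> \<alpha> =
     (let S = {card K | K. K \<noteq> {} \<and> K \<subseteq> {1..m} \<and> \<not> ctp_rejects m \<phi> \<alpha> K}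
      in if S = {} then 0 else Max S)"


section \<open>The statistical model\<close>

text \<open>
  The model is a set \<open>\<P>\<close> of probability measures on the measurable space underlying \<open>N\<close>, and a
  hypothesis is a set of probability measures, true under \<open>M \<in> \<P>\<close> iff it contains \<open>M\<close>.
\<close>

definition null_hyp :: "(nat \<Rightarrow> 'a measure set) \<Rightarrow> nat set \<Rightarrow> 'a measure set" where
  "null_hyp H J = (\<Inter>j\<in>J. H j)"

definition num_false :: "nat \<Rightarrow> (nat \<Rightarrow> 'a measure set) \<Rightarrow> 'a measure \<Rightarrow> nat" where
  "num_false m H M = card {i \<in> {1..m}. M \<notin> H i}"

definition valid_pvalues ::
  "nat \<Rightarrow> 'a measure \<Rightarrow> 'a measure set \<Rightarrow> (nat \<Rightarrow> 'a measure set) \<Rightarrow> (nat \<Rightarrow> 'a \<Rightarrow> real) \<Rightarrow> bool" where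
  "valid_pvalues m N \<P> H p \<longleftrightarrow>
     (\<forall>i\<in>{1..m}. p i \<in> borel_measurable N \<and> p i \<in> space N \<rightarrow> {0..1} \<and>
        (\<forall>M\<in>\<P> \<inter> H i. \<forall>a\<in>{0..1}. measure M {\<omega> \<in> space M. p i \<omega> \<le> a} \<le> a))"

text \<open>
  The common null distribution depends only on the size of the subset, hence is shared by all
  \<open>M \<in> \<P>\<close> under which the respective intersection hypothesis is true.  The case \<open>J' = J\<close>
  gives invariance under permutations.
\<close>

definition exchangeable_null ::
  "nat \<Rightarrow> 'a measure set \<Rightarrow> (nat \<Rightarrow> 'a measure set) \<Rightarrow> (nat \<Rightarrow> 'a \<Rightarrow> real) \<Rightarrow> bool" where
  "exchangeable_null m \<P> H p \<longleftrightarrow>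
     (\<forall>J J' f M M'. J \<noteq> {} \<longrightarrow> J \<subseteq> {1..m} \<longrightarrow> J' \<subseteq> {1..m} \<longrightarrow> bij_betw f J J' \<longrightarrow>
        M \<in> \<P> \<inter> null_hyp H J \<longrightarrow> M' \<in> \<P> \<inter> null_hyp H J' \<longrightarrow>
        distr M (Pi\<^sub>M J (\<lambda>_. borel)) (\<lambda>\<omega>. \<lambda>j\<in>J. p j \<omega>) =
        distr M' (Pi\<^sub>M J (\<lambda>_. borel)) (\<lambda>\<omega>. \<lambda>j\<in>J. p (f j) \<omega>))"

text \<open>
  If no intersection hypothesis of size \<open>k\<close> is ever true, \<open>G k\<close> is an arbitrary distribution function.
\<close>

definition null_cdfs ::
  "nat \<Rightarrow> 'a measure set \<Rightarrow> (nat \<Rightarrow> 'a measure set) \<Rightarrow> (nat \<Rightarrow> 'a \<Rightarrow> real) \<Rightarrow>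
   (nat \<Rightarrow> nat \<Rightarrow> real \<Rightarrow> real) \<Rightarrow> (nat \<Rightarrow> real list \<Rightarrow> real) \<Rightarrow> (nat \<Rightarrow> real \<Rightarrow> real) \<Rightarrow> bool" where
  "null_cdfs m \<P> H p F h G \<longleftrightarrow>
     (\<forall>k\<in>{1..m}.
        (\<exists>D. real_distribution D \<and> G k = cdf D) \<and>
        (\<forall>J M. J \<subseteq> {1..m} \<longrightarrow> card J = k \<longrightarrow> M \<in> \<P> \<inter> null_hyp H J \<longrightarrow>
           cdf (distr M borel (\<lambda>\<omega>. stat F h (\<lambda>i. p i \<omega>) J)) = G k))"


section \<open>Algorithms that compute local p-values\<close>

text \<open>
  Algorithms are finite decision trees.  A node \<open>Query R a b\<close> computes the local p-value of the
  hypotheses whose p-values have the ranks \<open>R\<close> in the sorted sequence, and continues with \<open>a\<close> if it is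
  at most the level and with \<open>b\<close> otherwise.  The functions \<open>F\<close>, \<open>h\<close>, \<open>G\<close>, the p-values and the level
  influence a run in no other way.
\<close>

datatype decision_tree = Output nat | Query "nat set" decision_tree decision_tree

text \<open>The oracle argument \<open>\<psi> R\<close> below is the local p-value for the set \<open>R\<close> of ranks.\<close>

primrec run :: "(nat set \<Rightarrow> real) \<Rightarrow> real \<Rightarrow> decision_tree \<Rightarrow> nat" where
  "run \<psi> \<alpha> (Output t) = t"
| "run \<psi> \<alpha> (Query R a b) = (if \<psi> R \<le> \<alpha> then run \<psi> \<alpha> a else run \<psi> \<alpha> b)"

primrec queries :: "(nat set \<Rightarrow> real) \<Rightarrow> real \<Rightarrow> decision_tree \<Rightarrow> nat set list" where
  "queries \<psi> \<alpha> (Output t) = []"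
| "queries \<psi> \<alpha> (Query R a b) = R # (if \<psi> R \<le> \<alpha> then queries \<psi> \<alpha> a else queries \<psi> \<alpha> b)"

text \<open>Worst-case number of local p-values computed.\<close>

primrec depth :: "decision_tree \<Rightarrow> nat" where
  "depth (Output t) = 0"
| "depth (Query R a b) = Suc (max (depth a) (depth b))"

text \<open>\<open>\<sigma> r\<close> is the index of the \<open>r\<close>-th smallest p-value, with ties broken arbitrarily.\<close>

definition sorts_pvalues :: "nat \<Rightarrow> (nat \<Rightarrow> real) \<Rightarrow> (nat \<Rightarrow> nat) \<Rightarrow> bool" where
  "sorts_pvalues m q \<sigma> \<longleftrightarrow> \<sigma> permutes {1..m} \<and> mono_on {1..m} (q \<circ> \<sigma>)"

definition rank_pvalue :: "(nat set \<Rightarrow> real) \<Rightarrow> (nat \<Rightarrow> nat) \<Rightarrow> nat set \<Rightarrow> real" where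
  "rank_pvalue \<phi> \<sigma> R = \<phi> (\<sigma> ` R)"

end

theory Submission
  imports Defs
begin

text \<open>
  The closed testing procedure fails to reject \<open>K\<close> exactly when some superset of \<open>K\<close> has a local
  p-value above the level \<open>\<alpha>\<close>.  Hence \<open>t\<^sub>\<alpha>\<close> is the largest size of a set whose own local p-value exceeds
  \<open>\<alpha>\<close> (\<open>le_t_alpha_iff\<close>), and the supersets disappear from the problem.

  For a fixed size \<open>k\<close> one set decides whether such a set exists: the set of the \<open>k\<close> largest p-values.
  Its sorted p-values dominate entrywise those of every other set of size \<open>k\<close>, and the functions
  \<open>F\<^sub>(\<^sub>j\<^sub>)\<close>, the statistic \<open>h\<close> and the distribution function \<open>G\<^sub>k\<close> are all monotone
  (for \<open>k = 1\<close> the local p-value is the p-value itself); this is \<open>local_pvalue_le_largest\<close>.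
  So it suffices to test the sets of the \<open>k\<close> largest p-values for \<open>k = m, m - 1, \<dots>\<close> until one exceeds \<open>\<alpha>\<close>, which takes at most one local p-value per size.

  For the coverage, let \<open>J\<close> be the set of the true hypotheses, which may be assumed nonempty since
  otherwise all \<open>m\<close> hypotheses are false.  If its local p-value exceeds \<open>\<alpha>\<close>,
  then \<open>|J| \<le> t\<^sub>\<alpha>\<close>, so the number \<open>m - |J|\<close> of false hypotheses is at least \<open>m - t\<^sub>\<alpha>\<close>.  The local p-value
  of \<open>J\<close> is at most \<open>\<alpha>\<close> with probability at most \<open>\<alpha>\<close>: for a single hypothesis this is the assumed
  validity of its p-value, and otherwise it holds because a random variable inserted into its own
  distribution function is stochastically at least uniform (\<open>cdf_transform_le\<close>).
\<close>

section \<open>The number computed by closed testing\<close>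

text \<open>
  Thresholds \<open>j \<ge> 1\<close> determine a natural number, and they absorb the convention \<open>t\<^sub>\<alpha> = 0\<close> for the case
  that everything is rejected; \<open>le_run_search_iff\<close> below has the same form so that the two can be
  compared.
\<close>

lemma le_t_alpha_iff:
  assumes "1 \<le> j"
  shows "j \<le> t_alpha m \<phi> \<alpha> \<longleftrightarrow> (\<exists>K\<subseteq>{1..m}. j \<le> card K \<and> \<alpha> < \<phi> K)"
proof -
  define S where "S = {card K | K. K \<noteq> {} \<and> K \<subseteq> {1..m} \<and> \<not> ctp_rejects m \<phi> \<alpha> K}"
  have t: "t_alpha m \<phi> \<alpha> = (if S = {} then 0 else Max S)"
    unfolding t_alpha_def S_def Let_def by simp
  have "S \<subseteq> card ` Pow {1..m}"
    unfolding S_def by auto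
  then have fin: "finite S"
    by (rule finite_subset) simp
  have "j \<le> t_alpha m \<phi> \<alpha> \<longleftrightarrow> (\<exists>s\<in>S. j \<le> s)"
    using assms fin by (auto simp: t Max_ge_iff)
  also have "\<dots> \<longleftrightarrow> (\<exists>K\<subseteq>{1..m}. j \<le> card K \<and> \<alpha> < \<phi> K)"
  proof
    assume "\<exists>s\<in>S. j \<le> s"
    then obtain K L where "j \<le> card K" "K \<subseteq> L" "L \<subseteq> {1..m}" "\<alpha> < \<phi> L"
      unfolding S_def ctp_rejects_def by (auto simp: not_le)
    moreover from this have "card K \<le> card L"
      by (meson card_mono finite_atLeastAtMost finite_subset)
    ultimately show "\<exists>K\<subseteq>{1..m}. j \<le> card K \<and> \<alpha> < \<phi> K"
      by (meson order_trans)
  next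
    assume "\<exists>K\<subseteq>{1..m}. j \<le> card K \<and> \<alpha> < \<phi> K"
    then obtain K where K: "K \<subseteq> {1..m}" "j \<le> card K" "\<alpha> < \<phi> K"
      by blast
    then have "K \<noteq> {}"
      using assms by auto
    moreover have "\<not> ctp_rejects m \<phi> \<alpha> K"
      unfolding ctp_rejects_def using K by (auto simp: not_le)
    ultimately have "card K \<in> S"
      unfolding S_def using K by blast
    then show "\<exists>s\<in>S. j \<le> s"
      using K by blast
  qed
  finally show ?thesis .
qed


section \<open>The algorithm\<close>

definition largest_ranks :: "nat \<Rightarrow> nat \<Rightarrow> nat set" where
  "largest_ranks m k = {m - k<..m}"

lemma card_largest_ranks: "k \<le> m \<Longrightarrow> card (largest_ranks m k) = k"
  unfolding largest_ranks_def by simp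

lemma largest_ranks_subset: "largest_ranks m k \<subseteq> {1..m}"
  unfolding largest_ranks_def by auto

primrec search :: "nat \<Rightarrow> nat \<Rightarrow> decision_tree" where
  "search m 0 = Output 0"
| "search m (Suc k) = Query (largest_ranks m (Suc k)) (search m k) (Output (Suc k))"

lemma depth_search: "depth (search m k) = k"
  by (induction k) auto

lemma le_run_search_iff:
  assumes "1 \<le> j"
  shows "j \<le> run \<psi> \<alpha> (search m k) \<longleftrightarrow> (\<exists>i\<in>{j..k}. \<alpha> < \<psi> (largest_ranks m i))"
proof (induction k)
  case 0
  then show ?case using assms by auto
next
  case (Suc k)
  show ?case
  proof (cases "\<psi> (largest_ranks m (Suc k)) \<le> \<alpha>")
    case True
    then have "(\<exists>i\<in>{j..Suc k}. \<alpha> < \<psi> (largest_ranks m i)) \<longleftrightarrow> (\<exists>i\<in>{j..k}. \<alpha> < \<psi> (largest_ranks m i))"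
      by (metis atLeastAtMost_iff le_Suc_eq not_le)
    then show ?thesis
      using True Suc by simp
  next
    case False
    then show ?thesis by (auto simp: not_le)
  qed
qed

lemma queries_search:
  "R \<in> set (queries \<psi> \<alpha> (search m k)) \<Longrightarrow> \<exists>i\<in>{1..k}. R = largest_ranks m i"
  by (induction k) (auto split: if_splits, force+)

lemma distinct_card_queries_search:
  assumes "k \<le> m"
  shows "distinct (map card (queries \<psi> \<alpha> (search m k)))"
  using assms
proof (induction k)
  case 0
  then show ?case by simp
next
  case (Suc k)
  have "card R \<le> k" if R: "R \<in> set (queries \<psi> \<alpha> (search m k))" for R
  proof -
    obtain i where "i \<in> {1..k}" "R = largest_ranks m i"
      using queries_search[OF R] by blast
    then show ?thesis
      using Suc.prems by (simp add: card_largest_ranks)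
  qed
  then have "Suc k \<notin> card ` set (queries \<psi> \<alpha> (search m k))"
    by fastforce
  then show ?case
    using Suc by (simp add: card_largest_ranks)
qed


section \<open>The largest p-values maximize the local p-value\<close>

lemma mset_sorted_list_of_set: "mset (sorted_list_of_set A) = mset_set A"
  by (metis mset_sorted_list_of_multiset sorted_list_of_mset_set)

lemma sorted_pvalues_image:
  assumes "finite R" "inj_on \<sigma> R" "mono_on R (q \<circ> \<sigma>)"
  shows "sorted_pvalues q (\<sigma> ` R) = map (q \<circ> \<sigma>) (sorted_list_of_set R)"
  unfolding sorted_pvalues_def
proof (rule properties_for_sort)
  show "mset (map (q \<circ> \<sigma>) (sorted_list_of_set R)) = mset (map q (sorted_list_of_set (\<sigma> ` R)))"
    using assms(2)
    by (simp add: mset_sorted_list_of_set image_mset_mset_set[symmetric] multiset.map_comp)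
  show "sorted (map (q \<circ> \<sigma>) (sorted_list_of_set R))"
    unfolding sorted_map
    by (rule sorted_wrt_mono_rel[OF _ sorted_sorted_list_of_set])
      (use assms in \<open>auto simp: mono_on_def\<close>)
qed

text \<open>
  The entry number \<open>i\<close> is followed by \<open>card R - i - 1\<close> larger elements, all of which must fit below \<open>m\<close>.
\<close>

lemma nth_sorted_list_of_set_le:
  fixes R :: "nat set"
  assumes R: "R \<subseteq> {1..m}" and i: "i < card R"
  shows "sorted_list_of_set R ! i \<le> m - card R + 1 + i"
proof -
  define xs where "xs = sorted_list_of_set R"
  have fin: "finite R"
    using R finite_subset by blast
  have xs: "sorted xs" "distinct xs" "length xs = card R" "set xs = R"
    unfolding xs_def using fin by auto
  have "set (drop i xs) \<subseteq> {xs ! i..m}"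
  proof
    fix x assume x: "x \<in> set (drop i xs)"
    then obtain j where "j < length xs - i" "x = xs ! (i + j)"
      by (auto simp: in_set_conv_nth)
    then have "xs ! i \<le> x"
      using xs(1) by (auto intro: sorted_nth_mono)
    moreover have "x \<le> m"
      using x R xs(4) in_set_dropD by fastforce
    ultimately show "x \<in> {xs ! i..m}" by simp
  qed
  then have "card (set (drop i xs)) \<le> card {xs ! i..m}"
    by (rule card_mono[rotated]) simp
  then have "card R - i \<le> Suc m - xs ! i"
    using xs by (simp add: distinct_card)
  moreover have "card R \<le> m"
    using card_mono[OF _ R] by simp
  ultimately show ?thesis
    using i unfolding xs_def by linarith
qed

lemma nth_sorted_list_of_largest_ranks:
  assumes "k \<le> m" "i < k"
  shows "sorted_list_of_set (largest_ranks m k) ! i = m - k + 1 + i"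
proof -
  have "largest_ranks m k = {m - k + 1..<Suc m}"
    unfolding largest_ranks_def by auto
  then show ?thesis
    using assms by (simp del: upt_Suc)
qed

lemma length_sorted_pvalues: "length (sorted_pvalues q J) = card J"
  unfolding sorted_pvalues_def by simp

lemma sorted_pvalues_le_largest:
  assumes \<sigma>: "sorts_pvalues m q \<sigma>" and J: "J \<subseteq> {1..m}" and i: "i < card J"
  shows "sorted_pvalues q J ! i \<le> sorted_pvalues q (\<sigma> ` largest_ranks m (card J)) ! i"
proof -
  have perm: "\<sigma> permutes {1..m}" and mono: "mono_on {1..m} (q \<circ> \<sigma>)"
    using \<sigma> unfolding sorts_pvalues_def by auto
  have sorted: "sorted_pvalues q (\<sigma> ` R) = map (q \<circ> \<sigma>) (sorted_list_of_set R)"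
    if "R \<subseteq> {1..m}" for R
    using that perm mono
    by (intro sorted_pvalues_image)
      (auto intro: finite_subset mono_on_subset inj_on_subset permutes_inj)
  define R where "R = inv \<sigma> ` J"
  have R: "R \<subseteq> {1..m}" "J = \<sigma> ` R" "card R = card J"
    unfolding R_def
    using J perm permutes_in_image[OF permutes_inv[OF perm]]
    by (auto simp: image_image permutes_inverses card_image inj_on_subset[OF permutes_inj[OF permutes_inv[OF perm]]])
  have fin: "finite R"
    using R finite_subset by blast
  have le_m: "card J \<le> m"
    using card_mono[OF _ J] by simp
  let ?L = "largest_ranks m (card J)"
  have L: "finite ?L" "card ?L = card J"
    using le_m by (simp_all add: largest_ranks_def)
  have "sorted_list_of_set R ! i \<in> {1..m}"
    using R i fin by (metis nth_mem sorted_list_of_set.length_sorted_key_list_of_set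
        sorted_list_of_set.set_sorted_key_list_of_set subsetD)
  moreover have "sorted_list_of_set ?L ! i \<in> {1..m}"
    using nth_sorted_list_of_largest_ranks[OF le_m i] le_m i by simp
  moreover have "sorted_list_of_set R ! i \<le> sorted_list_of_set ?L ! i"
    using nth_sorted_list_of_set_le[of R m i] nth_sorted_list_of_largest_ranks[OF le_m i] R i by simp
  ultimately have "(q \<circ> \<sigma>) (sorted_list_of_set R ! i) \<le> (q \<circ> \<sigma>) (sorted_list_of_set ?L ! i)"
    using mono by (auto simp: mono_on_def)
  then show ?thesis
    using R L i sorted[OF R(1)] sorted[OF largest_ranks_subset] by simp
qed

lemma vectors_length: "xs \<in> vectors k X \<Longrightarrow> length xs = k"
  unfolding vectors_def by simp

lemma vectors_nth: "xs \<in> vectors k X \<Longrightarrow> i < k \<Longrightarrow> xs ! i \<in> X"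
  unfolding vectors_def by (auto intro: subsetD[OF _ nth_mem])

lemma test_statistic_mono:
  assumes ts: "test_statistic k X F h"
    and xs: "xs \<in> vectors k {0..1}" and ys: "ys \<in> vectors k {0..1}"
    and le: "\<And>i. i < k \<Longrightarrow> xs ! i \<le> ys ! i"
  shows "h (map2 F [1..<Suc k] xs) \<le> h (map2 F [1..<Suc k] ys)"
proof -
  define Y where "Y zs = map2 F [1..<Suc k] zs" for zs
  note len = vectors_length[OF xs] vectors_length[OF ys]
  have C1: "F (Suc i) x \<le> F (Suc i) y" if "i < k" "x \<in> {0..1}" "y \<in> {0..1}" "x \<le> y" for i x y
    using that ts unfolding test_statistic_def cond_C1_def by (auto simp: mono_on_def)
  have nth: "Y zs ! i = F (Suc i) (zs ! i)" if "length zs = k" "i < k" for zs i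
    using that by (simp add: Y_def del: upt_Suc)
  have Y: "Y zs \<in> vectors k X" if zs: "zs \<in> vectors k {0..1}" for zs
  proof -
    have "Y zs ! i \<in> X" if "i < k" for i
    proof -
      have "F (Suc i) \<in> {0..1} \<rightarrow> X"
        using ts that unfolding test_statistic_def by simp
      then show ?thesis
        using vectors_nth[OF zs that] nth[OF vectors_length[OF zs] that] by auto
    qed
    moreover have "length (Y zs) = k"
      using vectors_length[OF zs] by (simp add: Y_def)
    ultimately show ?thesis
      unfolding vectors_def by (auto simp: in_set_conv_nth)
  qed
  define \<epsilon> where "\<epsilon> = map2 (-) (Y ys) (Y xs)"
  have lenY: "length (Y xs) = k" "length (Y ys) = k"
    using len by (simp_all add: Y_def)
  have "Y xs ! i \<le> Y ys ! i" if "i < k" for i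
    unfolding nth[OF len(1) that] nth[OF len(2) that]
    using that vectors_nth[OF xs that] vectors_nth[OF ys that] le[OF that] by (rule C1)
  then have "\<epsilon> \<in> vectors k {0..}"
    unfolding vectors_def \<epsilon>_def using lenY by (auto simp: in_set_conv_nth)
  moreover have "map2 (+) (Y xs) \<epsilon> = Y ys"
    unfolding \<epsilon>_def using lenY by (intro nth_equalityI) auto
  ultimately have "h (Y xs) \<le> h (Y ys)"
    using ts Y[OF xs] Y[OF ys] unfolding test_statistic_def cond_C3_def by metis
  then show ?thesis
    unfolding Y_def .
qed

lemma sorted_pvalues_in_vectors:
  assumes "finite J" "\<And>i. i \<in> J \<Longrightarrow> q i \<in> {0..1}"
  shows "sorted_pvalues q J \<in> vectors (card J) {0..1}"
  using assms unfolding vectors_def sorted_pvalues_def by auto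

lemma local_pvalue_le_largest:
  assumes \<sigma>: "sorts_pvalues m q \<sigma>" and q: "\<And>i. i \<in> {1..m} \<Longrightarrow> q i \<in> {0..1}"
    and J: "J \<subseteq> {1..m}" and k: "card J = k" "1 \<le> k"
    and ts: "test_statistic k (X k) (F k) (h k)" and G: "mono (G k)"
  shows "local_pvalue F h G q J \<le> local_pvalue F h G q (\<sigma> ` largest_ranks m k)"
proof -
  let ?L = "\<sigma> ` largest_ranks m k"
  have perm: "\<sigma> permutes {1..m}"
    using \<sigma> unfolding sorts_pvalues_def by auto
  have "k \<le> m"
    using card_mono[OF _ J] k by simp
  then have cardL: "card ?L = k"
    using perm by (simp add: card_image inj_on_subset[OF permutes_inj] card_largest_ranks)
  have L: "?L \<subseteq> {1..m}"
    using largest_ranks_subset[of m k] permutes_image[OF perm] by blast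
  have fin: "finite J" "finite ?L"
    using J L finite_subset by blast+
  have le: "sorted_pvalues q J ! i \<le> sorted_pvalues q ?L ! i" if "i < k" for i
    using sorted_pvalues_le_largest[OF \<sigma> J] that k by simp
  show ?thesis
  proof (cases "k = 1")
    case True
    then obtain a b where ab: "J = {a}" "?L = {b}"
      using k cardL by (metis card_1_singletonE)
    then have "q a \<le> q b"
      using le[of 0] True unfolding ab by (simp add: sorted_pvalues_def)
    then show ?thesis
      unfolding ab local_pvalue_def by simp
  next
    case False
    have "sorted_pvalues q J \<in> vectors k {0..1}"
      using sorted_pvalues_in_vectors[OF fin(1) q[OF subsetD[OF J]]] k by simp
    moreover have "sorted_pvalues q ?L \<in> vectors k {0..1}"
      using sorted_pvalues_in_vectors[OF fin(2) q[OF subsetD[OF L]]] cardL by simp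
    ultimately have "stat F h q J \<le> stat F h q ?L"
      unfolding stat_def Y_vec_def k cardL using le by (intro test_statistic_mono[OF ts])
    then show ?thesis
      using False k cardL G by (simp add: local_pvalue_def monoD)
  qed
qed

lemma run_search_eq_t_alpha:
  assumes \<sigma>: "\<sigma> permutes {1..m}"
    and max: "\<And>K. K \<noteq> {} \<Longrightarrow> K \<subseteq> {1..m} \<Longrightarrow> \<phi> K \<le> \<phi> (\<sigma> ` largest_ranks m (card K))"
  shows "run (rank_pvalue \<phi> \<sigma>) \<alpha> (search m m) = t_alpha m \<phi> \<alpha>"
proof -
  have "j \<le> run (rank_pvalue \<phi> \<sigma>) \<alpha> (search m m) \<longleftrightarrow> j \<le> t_alpha m \<phi> \<alpha>" if j: "1 \<le> j" for j
    unfolding le_run_search_iff[OF j] le_t_alpha_iff[OF j]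
  proof
    assume "\<exists>i\<in>{j..m}. \<alpha> < rank_pvalue \<phi> \<sigma> (largest_ranks m i)"
    then obtain i where i: "i \<in> {j..m}" "\<alpha> < \<phi> (\<sigma> ` largest_ranks m i)"
      unfolding rank_pvalue_def by blast
    have "card (\<sigma> ` largest_ranks m i) = i"
      using i \<sigma> by (simp add: card_image inj_on_subset[OF permutes_inj] card_largest_ranks)
    moreover have "\<sigma> ` largest_ranks m i \<subseteq> {1..m}"
      using largest_ranks_subset[of m i] permutes_image[OF \<sigma>] by blast
    ultimately show "\<exists>K\<subseteq>{1..m}. j \<le> card K \<and> \<alpha> < \<phi> K"
      using i by (intro exI[of _ "\<sigma> ` largest_ranks m i"]) simp
  next
    assume "\<exists>K\<subseteq>{1..m}. j \<le> card K \<and> \<alpha> < \<phi> K"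
    then obtain K where K: "K \<subseteq> {1..m}" "j \<le> card K" "\<alpha> < \<phi> K"
      by blast
    then have "K \<noteq> {}" "card K \<le> m"
      using j card_mono[OF _ K(1)] by auto
    with K max[of K] show "\<exists>i\<in>{j..m}. \<alpha> < rank_pvalue \<phi> \<sigma> (largest_ranks m i)"
      unfolding rank_pvalue_def by (intro bexI[of _ "card K"]) auto
  qed
  then show ?thesis
    by (metis le_antisym less_one linorder_not_le order_refl zero_le)
qed


section \<open>Coverage of the confidence set\<close>

lemma cdf_mono:
  assumes "real_distribution D"
  shows "mono (cdf D)"
proof -
  interpret real_distribution D by fact
  show ?thesis by (rule monoI) (rule cdf_nondecreasing)
qed

text \<open>
  The sublevel set \<open>{x. cdf D x \<le> a}\<close> is a half-line.  If it contains its supremum \<open>s\<close>, then its mass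
  is \<open>cdf D s\<close>; otherwise its mass is the left limit of the distribution function at \<open>s\<close>, which is a
  limit of values that are at most \<open>a\<close>.  The bound \<open>a < 1\<close> keeps the half-line from being everything.
\<close>

lemma cdf_transform_le:
  assumes "real_distribution D" and a: "0 \<le> a" "a < 1"
  shows "measure D {x. cdf D x \<le> a} \<le> a"
proof -
  interpret real_distribution D by fact
  define S where "S = {x. cdf D x \<le> a}"
  have "\<forall>\<^sub>F x in at_top. a < cdf D x"
    using order_tendstoD(1)[OF cdf_lim_at_top_prob a(2)] .
  then obtain b where b: "a < cdf D b"
    using eventually_happens by fastforce
  have down: "x \<in> S" if "y \<in> S" "x \<le> y" for x y
    using that cdf_nondecreasing[of x y] unfolding S_def by auto
  have bdd: "bdd_above S"
    using b down[of _ b] unfolding bdd_above_def S_def by (metis linorder_linear mem_Collect_eq not_le)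
  show ?thesis
  proof (cases "S = {}")
    case True
    then show ?thesis using a by (simp add: S_def)
  next
    case False
    define s where "s = Sup S"
    have le_s: "x \<le> s" if "x \<in> S" for x
      unfolding s_def using bdd that by (simp add: cSup_upper)
    have below: "x \<in> S" if "x < s" for x
      using that less_cSup_iff[OF False bdd] down unfolding s_def by (meson less_imp_le)
    show ?thesis
    proof (cases "s \<in> S")
      case True
      then have "S = {..s}"
        using down le_s by auto
      then have "measure D S = cdf D s"
        by (simp add: cdf_def)
      also have "\<dots> \<le> a"
        using True unfolding S_def by simp
      finally show ?thesis
        unfolding S_def .
    next
      case False
      then have "S = {..<s}"
        using below le_s by (metis (no_types, opaque_lifting) lessThan_iff order_le_less subsetI subset_antisym)
      moreover have "measure D {..<s} \<le> a"
      proof (rule tendsto_upperbound[OF cdf_at_left])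
        show "\<forall>\<^sub>F x in at_left s. cdf D x \<le> a"
          using below by (auto simp: eventually_at_filter S_def)
      qed simp
      ultimately show ?thesis
        unfolding S_def by simp
    qed
  qed
qed

lemma prob_local_pvalue_le:
  assumes "0 < \<alpha>" "\<alpha> < 1"
    and "valid_pvalues m N \<P> H p"
    and "null_cdfs m \<P> H p F h G"
    and "(\<lambda>\<omega>. stat F h (\<lambda>i. p i \<omega>) J) \<in> borel_measurable M"
    and J: "J \<noteq> {}" "J \<subseteq> {1..m}" "M \<in> \<P> \<inter> null_hyp H J" and "prob_space M"
  shows "measure M {\<omega>\<in>space M. local_pvalue F h G (\<lambda>i. p i \<omega>) J \<le> \<alpha>} \<le> \<alpha>"
proof (cases "card J = 1")
  case True
  then obtain i where i: "J = {i}"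
    by (rule card_1_singletonE)
  then have "i \<in> {1..m}" "M \<in> \<P> \<inter> H i"
    using J by (auto simp: null_hyp_def)
  then have "measure M {\<omega>\<in>space M. p i \<omega> \<le> \<alpha>} \<le> \<alpha>"
    using assms(1-3) unfolding valid_pvalues_def by auto
  then show ?thesis
    unfolding i local_pvalue_def by simp
next
  case False
  interpret prob_space M by fact
  let ?T = "\<lambda>\<omega>. stat F h (\<lambda>i. p i \<omega>) J"
  let ?D = "distr M borel ?T"
  have T: "?T \<in> borel_measurable M"
    by fact
  have fin: "finite J"
    using J finite_subset by blast
  have "card J \<in> {1..m}"
    using J fin card_mono[OF _ J(2)] by (auto simp: Suc_le_eq card_gt_0_iff)
  then have G: "G (card J) = cdf ?D"
    using assms(4) J unfolding null_cdfs_def by auto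
  have D: "real_distribution ?D"
    using T by simp
  have "cdf ?D \<in> borel_measurable borel"
    using cdf_mono[OF D] by (rule borel_measurable_mono)
  then have "{x. cdf ?D x \<le> \<alpha>} \<in> sets borel"
    by measurable
  then have "measure M {\<omega>\<in>space M. cdf ?D (?T \<omega>) \<le> \<alpha>} = measure ?D {x. cdf ?D x \<le> \<alpha>}"
    using T by (subst measure_distr) (auto intro: arg_cong[where f = "measure M"])
  then show ?thesis
    using False G cdf_transform_le[OF D, of \<alpha>] assms(1,2) by (simp add: local_pvalue_def)
qed

lemma local_pvalue_measurable:
  assumes p: "\<And>i. i \<in> {1..m} \<Longrightarrow> p i \<in> borel_measurable M"
    and T: "(\<lambda>\<omega>. stat F h (\<lambda>i. p i \<omega>) J) \<in> borel_measurable M"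
    and G: "mono (G (card J))" and J: "J \<subseteq> {1..m}"
  shows "(\<lambda>\<omega>. local_pvalue F h G (\<lambda>i. p i \<omega>) J) \<in> borel_measurable M"
proof (cases "card J = 1")
  case True
  then obtain i where "J = {i}"
    by (rule card_1_singletonE)
  then show ?thesis
    using J p by (simp add: local_pvalue_def)
next
  case False
  then show ?thesis
    using measurable_compose[OF T borel_measurable_mono[OF G]] by (simp add: local_pvalue_def)
qed

lemma coverage_t_alpha:
  fixes M :: "'a measure" and \<phi> :: "'a \<Rightarrow> nat set \<Rightarrow> real"
  assumes "prob_space M"
    and meas: "\<And>K. K \<noteq> {} \<Longrightarrow> K \<subseteq> {1..m} \<Longrightarrow> (\<lambda>\<omega>. \<phi> \<omega> K) \<in> borel_measurable M"
    and valid: "\<And>J. J \<noteq> {} \<Longrightarrow> J \<subseteq> {1..m} \<Longrightarrow> M \<in> null_hyp H J \<Longrightarrow>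
        measure M {\<omega>\<in>space M. \<phi> \<omega> J \<le> \<alpha>} \<le> \<alpha>"
    and \<alpha>: "0 < \<alpha>"
  shows "1 - \<alpha> \<le> measure M {\<omega>\<in>space M. num_false m H M \<in> {m - t_alpha m (\<phi> \<omega>) \<alpha>..m}}"
    (is "_ \<le> measure M ?E")
proof -
  interpret prob_space M by fact
  define J where "J = {i\<in>{1..m}. M \<in> H i}"
  have J: "J \<subseteq> {1..m}" "M \<in> null_hyp H J"
    unfolding J_def null_hyp_def by auto
  have fin: "finite J"
    unfolding J_def by simp
  have "{i\<in>{1..m}. M \<notin> H i} = {1..m} - J"
    unfolding J_def by auto
  then have "num_false m H M = m - card J"
    unfolding num_false_def using card_Diff_subset[OF fin J(1)] by simp
  moreover have "card J \<le> m"
    using card_mono[OF _ J(1)] by simp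
  ultimately have E: "?E = {\<omega>\<in>space M. card J \<le> t_alpha m (\<phi> \<omega>) \<alpha>}"
    by auto
  show ?thesis
  proof (cases "J = {}")
    case True
    then show ?thesis
      unfolding E using \<alpha> by (simp add: prob_space)
  next
    case False
    then have ge1: "1 \<le> card J"
      using fin by (simp add: Suc_le_eq card_gt_0_iff)
    have E': "?E = (\<Union>K\<in>{K. K \<subseteq> {1..m} \<and> card J \<le> card K}. {\<omega>\<in>space M. \<alpha> < \<phi> \<omega> K})"
      unfolding E le_t_alpha_iff[OF ge1] by auto
    \<comment> \<open>Non-measurable sets have measure 0 by convention, so the event itself has to be measurable.\<close>
    have "?E \<in> sets M"
      unfolding E'
    proof (intro sets.finite_UN)
      fix K assume "K \<in> {K. K \<subseteq> {1..m} \<and> card J \<le> card K}"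
      then have "K \<subseteq> {1..m}" "K \<noteq> {}"
        using ge1 by auto
      then have [measurable]: "(\<lambda>\<omega>. \<phi> \<omega> K) \<in> borel_measurable M"
        by (intro meas)
      show "{\<omega>\<in>space M. \<alpha> < \<phi> \<omega> K} \<in> sets M"
        by measurable
    qed simp
    moreover have "{\<omega>\<in>space M. \<alpha> < \<phi> \<omega> J} \<subseteq> ?E"
      unfolding E' using J by blast
    ultimately have "prob {\<omega>\<in>space M. \<alpha> < \<phi> \<omega> J} \<le> prob ?E"
      by (intro finite_measure_mono)
    moreover have [measurable]: "(\<lambda>\<omega>. \<phi> \<omega> J) \<in> borel_measurable M"
      using meas[OF False J(1)] .
    have "prob {\<omega>\<in>space M. \<alpha> < \<phi> \<omega> J} = 1 - prob {\<omega>\<in>space M. \<phi> \<omega> J \<le> \<alpha>}"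
      by (subst prob_neg[symmetric]) (auto simp: not_le)
    ultimately show ?thesis
      using valid[OF False J] by linarith
  qed
qed


section \<open>The confidence set for the number of false hypotheses\<close>

theorem mainTheorem5:
  shows "\<exists>A :: nat \<Rightarrow> decision_tree.
    (\<lambda>m. real (depth (A m))) \<in> O(\<lambda>m. real m) \<and>
    (\<forall>m (\<alpha> :: real) (N :: 'a measure) \<P> H p X F h G \<sigma>.
       2 \<le> m \<longrightarrow> 0 < \<alpha> \<longrightarrow> \<alpha> < 1 \<longrightarrow>
       \<P> \<subseteq> space (prob_algebra N) \<longrightarrow>
       valid_pvalues m N \<P> H p \<longrightarrow>
       exchangeable_null m \<P> H p \<longrightarrow>
       (\<forall>k\<in>{1..m}. test_statistic k (X k) (F k) (h k)) \<longrightarrow>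
       (\<forall>J. J \<noteq> {} \<longrightarrow> J \<subseteq> {1..m} \<longrightarrow> (\<lambda>\<omega>. stat F h (\<lambda>i. p i \<omega>) J) \<in> borel_measurable N) \<longrightarrow>
       null_cdfs m \<P> H p F h G \<longrightarrow>
       (\<forall>\<omega>\<in>space N. sorts_pvalues m (\<lambda>i. p i \<omega>) (\<sigma> \<omega>)) \<longrightarrow>
       (let \<phi> = (\<lambda>\<omega>. local_pvalue F h G (\<lambda>i. p i \<omega>));
            t = (\<lambda>\<omega>. run (rank_pvalue (\<phi> \<omega>) (\<sigma> \<omega>)) \<alpha> (A m));
            Q = (\<lambda>\<omega>. queries (rank_pvalue (\<phi> \<omega>) (\<sigma> \<omega>)) \<alpha> (A m))
        in (\<forall>\<omega>\<in>space N.
              t \<omega> = t_alpha m (\<phi> \<omega>) \<alpha> \<and>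
              (\<forall>R\<in>set (Q \<omega>). R \<noteq> {} \<and> R \<subseteq> {1..m}) \<and>
              distinct (map card (Q \<omega>))) \<and>
           (\<forall>M\<in>\<P>. measure M {\<omega> \<in> space M. num_false m H M \<in> {m - t \<omega>..m}} \<ge> 1 - \<alpha>)))"
proof (intro exI[of _ "\<lambda>m. search m m"] conjI allI impI)
  show "(\<lambda>m. real (depth (search m m))) \<in> O(\<lambda>m. real m)"
    by (simp add: depth_search)
next
  fix m :: nat and \<alpha> :: real and N :: "'a measure" and \<P> H p X F h G \<sigma>
  assume \<alpha>: "0 < \<alpha>" "\<alpha> < 1"
    and P: "\<P> \<subseteq> space (prob_algebra N)"
    and valid: "valid_pvalues m N \<P> H p"
    and ts: "\<forall>k\<in>{1..m}. test_statistic k (X k) (F k) (h k)"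
    and T: "\<forall>J. J \<noteq> {} \<longrightarrow> J \<subseteq> {1..m} \<longrightarrow> (\<lambda>\<omega>. stat F h (\<lambda>i. p i \<omega>) J) \<in> borel_measurable N"
    and cdfs: "null_cdfs m \<P> H p F h G"
    and \<sigma>: "\<forall>\<omega>\<in>space N. sorts_pvalues m (\<lambda>i. p i \<omega>) (\<sigma> \<omega>)"
  define \<phi> where "\<phi> = (\<lambda>\<omega>. local_pvalue F h G (\<lambda>i. p i \<omega>))"
  have size: "card K \<in> {1..m}" if "K \<noteq> {}" "K \<subseteq> {1..m}" for K
    using that card_mono[OF _ that(2)] finite_subset[OF that(2)]
    by (auto simp: Suc_le_eq card_gt_0_iff)
  have G: "mono (G k)" if "k \<in> {1..m}" for k
    using cdfs that cdf_mono unfolding null_cdfs_def by metis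
  have t: "run (rank_pvalue (\<phi> \<omega>) (\<sigma> \<omega>)) \<alpha> (search m m) = t_alpha m (\<phi> \<omega>) \<alpha>"
    if \<omega>: "\<omega> \<in> space N" for \<omega>
  proof (rule run_search_eq_t_alpha)
    show "\<sigma> \<omega> permutes {1..m}"
      using \<sigma> \<omega> unfolding sorts_pvalues_def by blast
    fix K assume K: "K \<noteq> {}" "K \<subseteq> {1..m}"
    have "p i \<omega> \<in> {0..1}" if "i \<in> {1..m}" for i
      using valid \<omega> that unfolding valid_pvalues_def by blast
    then show "\<phi> \<omega> K \<le> \<phi> \<omega> (\<sigma> \<omega> ` largest_ranks m (card K))"
      unfolding \<phi>_def using \<sigma> \<omega> K size[OF K] ts G
      by (intro local_pvalue_le_largest) auto
  qed
  have Q: "R \<noteq> {} \<and> R \<subseteq> {1..m}" if R: "R \<in> set (queries \<psi> \<alpha> (search m m))" for R \<psi>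
  proof -
    obtain i where "i \<in> {1..m}" "R = largest_ranks m i"
      using queries_search[OF R] by blast
    then show ?thesis
      by (auto simp: largest_ranks_def)
  qed
  have cover: "1 - \<alpha> \<le> measure M {\<omega>\<in>space M.
      num_false m H M \<in> {m - run (rank_pvalue (\<phi> \<omega>) (\<sigma> \<omega>)) \<alpha> (search m m)..m}}"
    if M: "M \<in> \<P>" for M
  proof -
    have prob: "prob_space M" and sets: "sets M = sets N"
      using P M by (auto simp: space_prob_algebra)
    have space: "space M = space N"
      using sets by (rule sets_eq_imp_space_eq)
    have T': "(\<lambda>\<omega>. stat F h (\<lambda>i. p i \<omega>) K) \<in> borel_measurable M"
      if "K \<noteq> {}" "K \<subseteq> {1..m}" for K
      using T that measurable_cong_sets[OF sets refl] by blast
    have p: "p i \<in> borel_measurable M" if "i \<in> {1..m}" for i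
      using valid that measurable_cong_sets[OF sets refl] unfolding valid_pvalues_def by blast
    have "1 - \<alpha> \<le> measure M {\<omega>\<in>space M. num_false m H M \<in> {m - t_alpha m (\<phi> \<omega>) \<alpha>..m}}"
    proof (rule coverage_t_alpha[OF prob _ _ \<alpha>(1)])
      fix K assume K: "K \<noteq> {}" "K \<subseteq> {1..m}"
      show "(\<lambda>\<omega>. \<phi> \<omega> K) \<in> borel_measurable M"
        unfolding \<phi>_def using p T'[OF K] G[OF size[OF K]] K(2) by (rule local_pvalue_measurable)
      assume "M \<in> null_hyp H K"
      then show "measure M {\<omega>\<in>space M. \<phi> \<omega> K \<le> \<alpha>} \<le> \<alpha>"
        unfolding \<phi>_def using M by (intro prob_local_pvalue_le[OF \<alpha> valid cdfs T'[OF K] K _ prob]) simp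
    qed
    also have "{\<omega>\<in>space M. num_false m H M \<in> {m - t_alpha m (\<phi> \<omega>) \<alpha>..m}} =
        {\<omega>\<in>space M. num_false m H M \<in> {m - run (rank_pvalue (\<phi> \<omega>) (\<sigma> \<omega>)) \<alpha> (search m m)..m}}"
      using t space by auto
    finally show ?thesis .
  qed
  show "let \<phi> = (\<lambda>\<omega>. local_pvalue F h G (\<lambda>i. p i \<omega>));
            t = (\<lambda>\<omega>. run (rank_pvalue (\<phi> \<omega>) (\<sigma> \<omega>)) \<alpha> (search m m));
            Q = (\<lambda>\<omega>. queries (rank_pvalue (\<phi> \<omega>) (\<sigma> \<omega>)) \<alpha> (search m m))
        in (\<forall>\<omega>\<in>space N.
              t \<omega> = t_alpha m (\<phi> \<omega>) \<alpha> \<and>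
              (\<forall>R\<in>set (Q \<omega>). R \<noteq> {} \<and> R \<subseteq> {1..m}) \<and>
              distinct (map card (Q \<omega>))) \<and>
           (\<forall>M\<in>\<P>. measure M {\<omega> \<in> space M. num_false m H M \<in> {m - t \<omega>..m}} \<ge> 1 - \<alpha>)"
    unfolding Let_def \<phi>_def[symmetric]
    using t Q cover distinct_card_queries_search[OF order_refl] by blast
qed

end
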